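(* Let $N$ and $m$ be positive integers and let $p$ be an integer. Then $$\sum_{n=0}^{N}\frac{(q\sqrt{k},-q\sqrt{k},y,z,k^2q^{N}/(yz),q^{-N};q)_n\,q^{(mn^2+(p+2)n)/2}}{(\sqrt{k},-\sqrt{k},qk/y,qk/z,yzq^{1-N}/k,kq^{1+N};q)_n\,(-q^{(m+p)/2};q^{m})_n}$$ $$=\frac{(1-k/y)(1-k/z)(1-kq^N)(1-kq^N/(yz))}{(1-k)(1-k/(yz))(1-kq^N/y)(1-kq^N/z)}\left(1-q^{(m-p)/2}\sum_{n=1}^{N}\frac{(y,z,k^2q^{N}/(yz),q^{-N};q)_{n}\,q^{(mn^2+(p-2m)n)/2}}{(k/y,k/z,kq^{N},yzq^{-N}/k;q)_{n}\,(-q^{(m+p)/2};q^{m})_n}\right).$$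
   Context: For an integer $n\ge 0$, $(x;q)_n=\prod_{i=0}^{n-1}(1-xq^i)$ (similarly $(x;q^m)_n$ with base $q^m$) and $(x_1,\dots,x_r;q)_n=\prod_{j=1}^r(x_j;q)_n$. Here $q,k,y,z$ are nonzero complex numbers such that none of the denominators vanish; $\sqrt k$ is a fixed square root of $k$, and half-integer powers of $q$ are taken with respect to a fixed square root $q^{1/2}$. *)

theory Defs
  imports Complex_Main
begin

definition qpoch :: "complex \<Rightarrow> complex \<Rightarrow> nat \<Rightarrow> complex" where
  "qpoch x q n = (\<Prod>i<n. 1 - x * q ^ i)"

text \<open>\<open>qpochs [x\<^sub>1, \<dots>, x\<^sub>r] q n\<close> is the multi-parameter symbol
  \<open>(x\<^sub>1, \<dots>, x\<^sub>r; q)\<^sub>n\<close>.\<close>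

definition qpochs :: "complex list \<Rightarrow> complex \<Rightarrow> nat \<Rightarrow> complex" where
  "qpochs xs q n = (\<Prod>x\<leftarrow>xs. qpoch x q n)"

end

theory Submission
  imports Defs
begin

text \<open>Put \<open>w = k\<^sup>2 q\<^sup>N / (y z)\<close> and \<open>v = q\<^sup>-\<^sup>N\<close>, so that \<open>y z w v = k\<^sup>2\<close>. For four parameters \<open>x\<^sub>i\<close>
  with product \<open>k\<^sup>2\<close>, the polynomial \<open>\<Prod>(1 - x\<^sub>i t) - \<Prod>(1 - k t / x\<^sub>i)\<close> is a constant multiple of
  \<open>t (1 - k t\<^sup>2)\<close>. Hence the very-well-poised part of the left-hand summand is a constant
  multiple of \<open>B\<^sub>n - B\<^sub>n\<^sub>+\<^sub>1\<close>, where \<open>B\<^sub>n = \<Prod>(x\<^sub>i; q)\<^sub>n / (k / x\<^sub>i; q)\<^sub>n\<close>. Since \<open>B\<^sub>N\<^sub>+\<^sub>1 = 0\<close>, summation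
  by parts moves the difference onto
  \<open>g\<^sub>n = q\<^bsup>(m n\<^sup>2 + p n)/2\<^esup> / (-q\<^bsup>(m + p)/2\<^esup>; q\<^sup>m)\<^sub>n\<close>, whose difference \<open>g\<^sub>n - g\<^sub>n\<^sub>-\<^sub>1\<close> is a single term.\<close>

lemma qpoch_0 [simp]: "qpoch x q 0 = 1"
  by (simp add: qpoch_def)

lemma qpoch_Suc: "qpoch x q (Suc n) = qpoch x q n * (1 - x * q ^ n)"
  by (simp add: qpoch_def mult.commute)

lemma qpoch_Suc_shift: "qpoch x q (Suc n) = (1 - x) * qpoch (q * x) q n"
  unfolding qpoch_def prod.lessThan_Suc_shift by (simp add: mult_ac)

lemma qpochs_Nil [simp]: "qpochs [] q n = 1"
  by (simp add: qpochs_def)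

lemma qpochs_Cons [simp]: "qpochs (x # xs) q n = qpoch x q n * qpochs xs q n"
  by (simp add: qpochs_def)

text \<open>Both sides equal (s;q)_{n+1} (-s;q)_{n+1}, with either the first or the last factors
  split off. At \<open>s = k_sqrt\<close> this produces the very-well-poised factor (1 - k
  q^(2n))/(1 - k).\<close>

lemma qpoch_very_well_poised:
  "(1 - s ^ 2) * (qpoch (q * s) q n * qpoch (- (q * s)) q n)
    = qpoch s q n * qpoch (- s) q n * (1 - s ^ 2 * q ^ (2 * n))"
proof -
  have "(1 - s ^ 2) * (qpoch (q * s) q n * qpoch (- (q * s)) q n)
      = ((1 - s) * qpoch (q * s) q n) * ((1 - (- s)) * qpoch (q * (- s)) q n)"
    by (simp add: power2_eq_square algebra_simps)
  also have "\<dots> = qpoch s q n * (1 - s * q ^ n) * (qpoch (- s) q n * (1 - (- s) * q ^ n))"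
    by (simp only: qpoch_Suc_shift [symmetric] qpoch_Suc)
  also have "\<dots> = qpoch s q n * qpoch (- s) q n * (1 - s ^ 2 * q ^ (2 * n))"
    by (simp add: power2_eq_square power_mult mult_2 power_add algebra_simps)
  finally show ?thesis .
qed

text \<open>Compare coefficients in \<open>t\<close>. As the product is \<open>k ^ 2\<close>,
  replacing each x by k/x turns a pair product into the complementary one, so the quartics agree in
  degrees 0, 2 and 4. A triple product becomes \<open>k\<close> times the omitted parameter, so in
  the difference the cubic coefficient is \<open>- k\<close> times the linear one.\<close>

lemma well_poised_quartic:
  fixes a b c d k t :: "'a :: field"
  assumes "k \<noteq> 0" and prod: "a * b * c * d = k ^ 2"
  shows "(1 - k / a * t) * (1 - k / b * t) * (1 - k / c * t) * (1 - k / d * t)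
      - (1 - a * t) * (1 - b * t) * (1 - c * t) * (1 - d * t)
    = (a + b + c + d - k / a - k / b - k / c - k / d) * (t * (1 - k * t ^ 2))"
proof -
  have nz: "a \<noteq> 0" "b \<noteq> 0" "c \<noteq> 0" "d \<noteq> 0"
    using assms by auto
  define A B C D where "A = k / a" "B = k / b" "C = k / c" "D = k / d"
  note defs = A_B_C_D_def
  have pairs: "a * A = k" "b * B = k" "c * C = k" "d * D = k"
    using nz by (simp_all add: defs)
  have e2: "A * B = c * d" "A * C = b * d" "A * D = b * c" "B * C = a * d" "B * D = a * c" "C * D = a * b"
    using nz prod by (simp_all add: defs field_simps power2_eq_square)
  have e3: "A * B * C = k * d" "A * B * D = k * c" "A * C * D = k * b" "B * C * D = k * a"
    using e2 pairs by algebra+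
  have e4: "A * B * C * D = k ^ 2"
    using e3(1) pairs(4) by (simp add: power2_eq_square mult_ac)
  have f3: "a * b * c = k * D" "a * b * d = k * C" "a * c * d = k * B" "b * c * d = k * A"
    using e2 pairs by algebra+
  have expand: "(1 - p * t) * (1 - q * t) * (1 - r * t) * (1 - s * t)
      = 1 - (p + q + r + s) * t + (p * q + p * r + p * s + q * r + q * s + r * s) * t ^ 2
        - (p * q * r + p * q * s + p * r * s + q * r * s) * t ^ 3 + p * q * r * s * t ^ 4"
    for p q r s :: 'a
    by (simp add: algebra_simps power2_eq_square power3_eq_cube power4_eq_xxxx)
  show ?thesis
    \<comment> \<open>Longer products are rewritten first: \<open>A * B\<close> is a subterm of
      \<open>A * B * C\<close>, and that of \<open>A * B * C * D\<close>.\<close>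
    unfolding defs [symmetric] expand unfolding e4 prod unfolding e3 f3 unfolding e2
    by (simp add: algebra_simps power2_eq_square power3_eq_cube)
qed

text \<open>Factors the constant of \<open>well_poised_quartic\<close> for the parameters
  \<open>y\<close>, \<open>z\<close>, \<open>w\<close>, \<open>v\<close>. As \<open>k / w\<close> is
  the reciprocal of \<open>k * Q / (y * z)\<close>, the factors \<open>1 - k / w\<close> and
  \<open>1 - k * Q / (y * z)\<close> differ by a monomial; keeping one on each side avoids a
  division.\<close>

lemma well_poised_const:
  fixes k y z Q :: "'a :: field"
  assumes "k \<noteq> 0" "y \<noteq> 0" "z \<noteq> 0" "Q \<noteq> 0"
  defines "w \<equiv> k ^ 2 * Q / (y * z)" and "v \<equiv> inverse Q"
  shows "(y + z + w + v - k / y - k / z - k / w - k / v) * (1 - k * Q / (y * z))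
    = (1 - k / w) * ((1 - k / (y * z)) * (1 - k * Q / y) * (1 - k * Q / z))"
proof -
  \<comment> \<open>In \<open>x\<close>, \<open>u\<close>, \<open>r\<close>, \<open>y\<close>,
    \<open>z\<close> all quantities involved become monomials, leaving a polynomial identity modulo
    \<open>u * x = 1\<close>.\<close>
  define x where "x = k * Q / (y * z)"
  define u where "u = inverse x"
  define r where "r = k / (y * z)"
  have ux: "u * x = 1"
    using assms(1-4) by (simp add: u_def x_def)
  have eqs: "w = r * x * y * z" "v = r * u" "k / y = r * z" "k / z = r * y" "k / w = u" "k / v = x * y * z"
      "k * Q / y = x * z" "k * Q / z = x * y"
    using assms(1-4) by (simp_all add: w_def v_def x_def u_def r_def field_simps power2_eq_square)
  have "(y + z + r * x * y * z + r * u - r * z - r * y - u - x * y * z) * (1 - x)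
      = (1 - u) * ((1 - r) * (1 - x * z) * (1 - x * y))"
    using ux by algebra
  then show ?thesis
    unfolding x_def [symmetric] r_def [symmetric] unfolding eqs(3-8) unfolding eqs(1,2) .
qed

text \<open>Over the common denominator the numerator is the quartic difference at
  \<open>t = q ^ n\<close>. The denominator stays at \<open>Suc n\<close> because splitting off its
  first factors yields the lower parameters q k/x of the left-hand sum.\<close>

lemma well_poised_telescope:
  assumes "k \<noteq> 0" and prod: "a * b * c * d = k ^ 2"
    and nz: "qpochs [k / a, k / b, k / c, k / d] q (Suc n) \<noteq> 0"
  shows "qpochs [a, b, c, d] q n / qpochs [k / a, k / b, k / c, k / d] q n
      - qpochs [a, b, c, d] q (Suc n) / qpochs [k / a, k / b, k / c, k / d] q (Suc n)
    = (a + b + c + d - k / a - k / b - k / c - k / d) * (q ^ n * (1 - k * q ^ (2 * n)))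
      * (qpochs [a, b, c, d] q n / qpochs [k / a, k / b, k / c, k / d] q (Suc n))"
proof -
  define P where "P = qpochs [a, b, c, d] q n"
  define K where "K = qpochs [k / a, k / b, k / c, k / d] q n"
  define u where "u = (1 - a * q ^ n) * (1 - b * q ^ n) * (1 - c * q ^ n) * (1 - d * q ^ n)"
  define l where "l = (1 - k / a * q ^ n) * (1 - k / b * q ^ n) * (1 - k / c * q ^ n) * (1 - k / d * q ^ n)"
  have PS: "qpochs [a, b, c, d] q (Suc n) = P * u"
    by (simp add: P_def u_def qpoch_Suc mult_ac)
  have KS: "qpochs [k / a, k / b, k / c, k / d] q (Suc n) = K * l"
    by (simp add: K_def l_def qpoch_Suc mult_ac)
  have "K \<noteq> 0" "l \<noteq> 0"
    using nz unfolding KS by auto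
  then have "P / K - P * u / (K * l) = (l - u) * (P / (K * l))"
    by (simp add: field_simps)
  moreover have "l - u = (a + b + c + d - k / a - k / b - k / c - k / d)
      * (q ^ n * (1 - k * q ^ (2 * n)))"
    using well_poised_quartic [OF assms(1) prod, of "q ^ n"]
    by (simp add: l_def u_def mult.commute [of 2 n] flip: power_mult)
  ultimately show ?thesis
    unfolding PS KS P_def [symmetric] K_def [symmetric] by simp
qed

lemma sum_by_parts:
  fixes B g :: "nat \<Rightarrow> 'a :: comm_ring_1"
  shows "(\<Sum>n = 0..N. (B n - B (Suc n)) * g n)
    = B 0 * g 0 + (\<Sum>n = 1..N. B n * (g n - g (n - 1))) - B (Suc N) * g N"
  by (induction N) (simp_all add: algebra_simps)

text \<open>Half-integer powers q^(j/2) are encoded as \<open>h powi j\<close>; this merges ordinary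
  powers of \<open>q\<close> into them.\<close>

lemma power2_powi:
  fixes h q :: "'a :: field"
  assumes "h ^ 2 = q"
  shows "q ^ n = h powi (2 * int n)"
proof -
  have "q ^ n = h ^ (2 * n)"
    by (simp only: power_mult assms)
  also have "\<dots> = h powi int (2 * n)"
    by (simp only: power_int_of_nat)
  finally show ?thesis
    by simp
qed

text \<open>From \<open>n\<close> to \<open>Suc n\<close> the numerator gains a factor
  \<open>s\<close> and the denominator \<open>1 + s\<close>, so the difference is -E/(T (1 + s)).
  The factor \<open>h powi (int m - p)\<close> arises from rewriting the exponent of
  \<open>E\<close> in terms of \<open>Suc n\<close>.\<close>

lemma theta_quotient_diff:
  fixes h q :: complex and m n :: nat and p :: int
  assumes "h \<noteq> 0" "h ^ 2 = q"
    and nz: "qpoch (- (h powi (int m + p))) (q ^ m) (Suc n) \<noteq> 0"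
  defines "g \<equiv> \<lambda>n. h powi (int m * int n ^ 2 + p * int n) / qpoch (- (h powi (int m + p))) (q ^ m) n"
  shows "g (Suc n) - g n
    = - (h powi (int m - p) * (h powi (int m * int (Suc n) ^ 2 + (p - 2 * int m) * int (Suc n))
        / qpoch (- (h powi (int m + p))) (q ^ m) (Suc n)))"
proof -
  define s where "s = h powi (int m + p + 2 * int (m * n))"
  define E where "E = h powi (int m * int n ^ 2 + p * int n)"
  define T where "T = qpoch (- (h powi (int m + p))) (q ^ m) n"
  have "(q ^ m) ^ n = h powi (2 * int (m * n))"
    using power2_powi [OF assms(2), of "m * n"] by (simp only: power_mult)
  then have TS: "qpoch (- (h powi (int m + p))) (q ^ m) (Suc n) = T * (1 + s)"
    using assms(1) by (simp add: qpoch_Suc T_def s_def power_int_add)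
  have "T \<noteq> 0" "1 + s \<noteq> 0"
    using nz by (auto simp: TS)
  have ES: "h powi (int m * int (Suc n) ^ 2 + p * int (Suc n)) = E * s"
  proof -
    have "int m * int (Suc n) ^ 2 + p * int (Suc n)
        = (int m * int n ^ 2 + p * int n) + (int m + p + 2 * int (m * n))"
      by (simp add: algebra_simps power2_eq_square)
    then show ?thesis
      using assms(1) by (simp only: E_def s_def power_int_add simp_thms)
  qed
  have EE: "h powi (int m - p) * (h powi (int m * int (Suc n) ^ 2 + (p - 2 * int m) * int (Suc n))) = E"
  proof -
    have "int m * int n ^ 2 + p * int n
        = (int m - p) + (int m * int (Suc n) ^ 2 + (p - 2 * int m) * int (Suc n))"
      by (simp add: algebra_simps power2_eq_square)
    then show ?thesis
      using assms(1) by (simp only: E_def power_int_add simp_thms)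
  qed
  have "g (Suc n) - g n = E * s / (T * (1 + s)) - E / T"
    by (simp only: g_def TS ES E_def T_def)
  also have "\<dots> = - (E / (T * (1 + s)))"
    using \<open>T \<noteq> 0\<close> \<open>1 + s \<noteq> 0\<close> by (simp add: divide_simps) (simp add: algebra_simps)
  finally show ?thesis
    by (simp only: TS times_divide_eq_right EE)
qed

theorem corollary7:
  fixes N m :: nat and p :: int and q k y z q_half k_sqrt :: complex
  assumes "N > 0" and "m > 0"
    and "q \<noteq> 0" and "k \<noteq> 0" and "y \<noteq> 0" and "z \<noteq> 0"
    and "q_half ^ 2 = q" and "k_sqrt ^ 2 = k"
    and "\<And>n. n \<in> {0..N} \<Longrightarrow>
      qpochs [k_sqrt, - k_sqrt, q * k / y, q * k / z,
              y * z * q powi (1 - int N) / k, k * q ^ (1 + N)] q n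
        * qpoch (- (q_half powi (int m + p))) (q ^ m) n \<noteq> 0"
    and "\<And>n. n \<in> {1..N} \<Longrightarrow>
      qpochs [k / y, k / z, k * q ^ N, y * z * q powi (- int N) / k] q n
        * qpoch (- (q_half powi (int m + p))) (q ^ m) n \<noteq> 0"
    and "(1 - k) * (1 - k / (y * z)) * (1 - k * q ^ N / y) * (1 - k * q ^ N / z) \<noteq> 0"
  shows "(\<Sum>n = 0..N.
      qpochs [q * k_sqrt, - (q * k_sqrt), y, z, k ^ 2 * q ^ N / (y * z), q powi (- int N)] q n
        * q_half powi (int m * int n ^ 2 + (p + 2) * int n)
      / (qpochs [k_sqrt, - k_sqrt, q * k / y, q * k / z,
                 y * z * q powi (1 - int N) / k, k * q ^ (1 + N)] q n
        * qpoch (- (q_half powi (int m + p))) (q ^ m) n))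
    = (1 - k / y) * (1 - k / z) * (1 - k * q ^ N) * (1 - k * q ^ N / (y * z))
      / ((1 - k) * (1 - k / (y * z)) * (1 - k * q ^ N / y) * (1 - k * q ^ N / z))
      * (1 - q_half powi (int m - p) *
          (\<Sum>n = 1..N.
            qpochs [y, z, k ^ 2 * q ^ N / (y * z), q powi (- int N)] q n
              * q_half powi (int m * int n ^ 2 + (p - 2 * int m) * int n)
            / (qpochs [k / y, k / z, k * q ^ N, y * z * q powi (- int N) / k] q n
              * qpoch (- (q_half powi (int m + p))) (q ^ m) n)))"
proof -
  define w where "w = k ^ 2 * q ^ N / (y * z)"
  define v where "v = q powi (- int N)"
  define P where "P = qpochs [y, z, w, v] q"
  define K where "K = qpochs [k / y, k / z, k / w, k / v] q"
  define L where "L = qpochs [q * (k / y), q * (k / z), q * (k / w), q * (k / v)] q"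
  define R where "R = qpochs [k_sqrt, - k_sqrt] q"
  define T where "T = qpoch (- (q_half powi (int m + p))) (q ^ m)"
  define g where "g n = q_half powi (int m * int n ^ 2 + p * int n) / T n" for n :: nat
  define B where "B n = P n / K n" for n
  define c where "c = y + z + w + v - k / y - k / z - k / w - k / v"
  define F where "F = (1 - k / y) * (1 - k / z) * (1 - k / w) * (1 - k / v)"
  define G where "G = (1 - k / (y * z)) * (1 - k * q ^ N / y) * (1 - k * q ^ N / z)"
  note nz = \<open>q \<noteq> 0\<close> \<open>k \<noteq> 0\<close> \<open>y \<noteq> 0\<close> \<open>z \<noteq> 0\<close>
  have h: "q_half \<noteq> 0"
    using \<open>q_half ^ 2 = q\<close> nz by auto
  have v: "v = inverse (q ^ N)" "k / v = k * q ^ N"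
    using nz by (simp_all add: v_def power_int_minus divide_inverse)
  have w: "k / w = y * z * q powi (- int N) / k"
    using nz by (simp_all add: w_def power_int_minus field_simps power2_eq_square)
  have prod: "y * z * w * v = k ^ 2"
    using nz by (simp add: w_def v(1))
  have qw: "q * (k / w) = y * z * q powi (1 - int N) / k"
    using nz by (simp add: w(1) power_int_diff power_int_minus field_simps)
  have qv: "q * (k / v) = k * q ^ (1 + N)"
    by (simp add: v(2))
  have KL: "K (Suc n) = F * L n" for n
    by (simp add: K_def L_def F_def qpoch_Suc_shift mult_ac)
  have D1: "qpochs [k_sqrt, - k_sqrt, q * k / y, q * k / z,
              y * z * q powi (1 - int N) / k, k * q ^ (1 + N)] q n = R n * L n" for n
    unfolding L_def R_def qw qv by (simp add: mult_ac)
  have D2: "qpochs [k / y, k / z, k * q ^ N, y * z * q powi (- int N) / k] q n = K n" for n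
    unfolding K_def w(1) v(2) by (simp add: mult_ac)
  have nz1: "R n \<noteq> 0" "L n \<noteq> 0" "T n \<noteq> 0" if "n \<le> N" for n
    using assms(9) [of n] that unfolding D1 T_def [symmetric] by auto
  \<comment> \<open>\<open>K 1\<close> equals \<open>F\<close>, so the right-hand denominator at n =
    1, which occurs since \<open>N > 0\<close>, controls all four factors of
    \<open>F\<close>.\<close>
  have "K 1 \<noteq> 0"
    using assms(10) [of 1] \<open>N > 0\<close> unfolding D2 by auto
  then have F: "F \<noteq> 0"
    using KL [of 0] by auto
  \<comment> \<open>This reaches \<open>Suc N\<close>, one index beyond the right-hand denominators,
    through the left-hand ones.\<close>
  have K: "K (Suc n) \<noteq> 0" if "n \<le> N" for n
    using KL F nz1(2) that by simp
  have k1: "1 - k \<noteq> 0" and G: "G \<noteq> 0"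
    using assms(11) by (auto simp: G_def)
  have cG: "c * (1 - k * q ^ N / (y * z)) = (1 - k / w) * G"
    using well_poised_const [of k y z "q ^ N"] nz by (simp add: c_def G_def w_def v(1))
  have "1 - k / w \<noteq> 0"
    using F by (auto simp: F_def)
  then have c: "c \<noteq> 0"
    using cG G by auto
  \<comment> \<open>The prefactor of the theorem is what remains after dividing by the telescoping
    constant \<open>c\<close>: \<open>F\<close> comes from \<open>KL\<close>, and
    \<open>1 - k\<close> from the very-well-poised factor.\<close>
  have const: "(1 - k / y) * (1 - k / z) * (1 - k * q ^ N) * (1 - k * q ^ N / (y * z))
      / ((1 - k) * (1 - k / (y * z)) * (1 - k * q ^ N / y) * (1 - k * q ^ N / z))
    = F / (c * (1 - k))"
  proof -
    define r where "r = 1 - k * q ^ N / (y * z)"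
    define S where "S = (1 - k / y) * (1 - k / z) * (1 - k * q ^ N)"
    have "F * G = S * (c * r)"
      using cG by (simp add: F_def S_def r_def v(2) mult_ac)
    then have "S * r / ((1 - k) * G) = F / (c * (1 - k))"
      using c G k1 by (simp add: field_simps)
    then show ?thesis
      by (simp add: S_def r_def G_def mult.assoc)
  qed
  have summand: "qpochs [q * k_sqrt, - (q * k_sqrt), y, z, k ^ 2 * q ^ N / (y * z), q powi (- int N)] q n
        * q_half powi (int m * int n ^ 2 + (p + 2) * int n) / (R n * L n * T n)
      = F / (c * (1 - k)) * ((B n - B (Suc n)) * g n)" if "n \<le> N" for n
  proof -
    \<comment> \<open>The extra 2 in \<open>p + 2\<close> supplies the factor \<open>q ^ n\<close>,
      the \<open>t\<close> in t (1 - k t^2).\<close>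
    have e: "q_half powi (int m * int n ^ 2 + (p + 2) * int n)
        = q_half powi (int m * int n ^ 2 + p * int n) * q ^ n"
    proof -
      have "int m * int n ^ 2 + (p + 2) * int n = (int m * int n ^ 2 + p * int n) + 2 * int n"
        by (simp add: algebra_simps)
      then show ?thesis
        using h by (simp only: power2_powi [OF \<open>q_half ^ 2 = q\<close>] power_int_add simp_thms)
    qed
    define d where "d = 1 - k * q ^ (2 * n)"
    define V where "V = qpoch (q * k_sqrt) q n * qpoch (- (q * k_sqrt)) q n"
    have V: "V = R n * d / (1 - k)"
      using qpoch_very_well_poised [of k_sqrt q n] k1 \<open>k_sqrt ^ 2 = k\<close>
      by (simp add: V_def R_def d_def field_simps)
    have num: "qpochs [q * k_sqrt, - (q * k_sqrt), y, z, k ^ 2 * q ^ N / (y * z), q powi (- int N)] q n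
        = V * P n"
      by (simp add: V_def P_def w_def v_def mult_ac)
    have B: "B n - B (Suc n) = c * (q ^ n * d) * (P n / K (Suc n))"
      unfolding B_def P_def K_def c_def d_def
      by (rule well_poised_telescope [OF nz(2) prod K [OF that, unfolded K_def]])
    show ?thesis
      using nz1 [OF that] c F k1
      unfolding num V e B g_def KL by (simp add: field_simps)
  qed
  \<comment> \<open>The last factor is 1 - q^(-N) q^N, which removes the upper boundary
    term.\<close>
  have "qpoch v q (Suc N) = 0"
    using nz by (simp add: qpoch_Suc v(1))
  then have BN: "B (Suc N) = 0"
    by (simp add: B_def P_def)
  have B0: "B 0 * g 0 = 1"
    by (simp add: B_def P_def K_def g_def T_def)
  have diff: "B n * (g n - g (n - 1)) = - (q_half powi (int m - p) *
      (qpochs [y, z, k ^ 2 * q ^ N / (y * z), q powi (- int N)] q n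
        * q_half powi (int m * int n ^ 2 + (p - 2 * int m) * int n) / (K n * T n)))"
    if "n \<in> {1..N}" for n
  proof -
    obtain n' where n': "n = Suc n'"
      using \<open>n \<in> {1..N}\<close> by (cases n) auto
    have "qpoch (- (q_half powi (int m + p))) (q ^ m) (Suc n') \<noteq> 0"
      using nz1(3) [of n] \<open>n \<in> {1..N}\<close> by (simp add: T_def n')
    from theta_quotient_diff [OF h \<open>q_half ^ 2 = q\<close> this]
    have "g n - g (n - 1) = - (q_half powi (int m - p)
        * (q_half powi (int m * int n ^ 2 + (p - 2 * int m) * int n) / T n))"
      by (simp only: g_def T_def n' diff_Suc_1)
    then show ?thesis
      by (simp only: B_def P_def w_def v_def) (simp add: field_simps)
  qed
  have "(\<Sum>n = 0..N.
      qpochs [q * k_sqrt, - (q * k_sqrt), y, z, k ^ 2 * q ^ N / (y * z), q powi (- int N)] q n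
        * q_half powi (int m * int n ^ 2 + (p + 2) * int n) / (R n * L n * T n))
    = F / (c * (1 - k)) * (\<Sum>n = 0..N. (B n - B (Suc n)) * g n)"
    unfolding sum_distrib_left by (intro sum.cong refl summand) simp
  also have "(\<Sum>n = 0..N. (B n - B (Suc n)) * g n)
    = 1 - q_half powi (int m - p) * (\<Sum>n = 1..N.
        qpochs [y, z, k ^ 2 * q ^ N / (y * z), q powi (- int N)] q n
          * q_half powi (int m * int n ^ 2 + (p - 2 * int m) * int n) / (K n * T n))"
    unfolding sum_by_parts BN B0 sum_distrib_left
    by (simp only: sum.cong [OF refl diff] sum_negf) simp
  finally show ?thesis
    unfolding D1 D2 T_def [symmetric] const .
qed

end
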